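(* Consider the $m$-layer input convex neural network (ICNN) mapping an input vector $x$ to the output vector $z_m$ through the layer-wise computations $$z_1 = g_1(W_1 x + b_1), \qquad z_l = g_l\left(W_l z_{l-1} + D_l x + b_l\right), \quad l = 2,\dots,m,$$ where $W_1,\dots,W_m$ and $D_2,\dots,D_m$ are real matrices, $b_1,\dots,b_m$ are real vectors (all of compatible dimensions), and each activation function $g_l:\mathbb{R}\to\mathbb{R}$ is applied componentwise. If all entries of $W_2,\dots,W_m$ are non-negative and all functions $g_1,\dots,g_m$ are convex and non-decreasing, then the network is a convex function from its inputs to its outputs; that is, each component of $z_m$ is a convex function of $x$.
   Context: The input $x$ and the output $z_m$ may be vectors of arbitrary finite dimension. The matrices $D_l$ are direct "passthrough" connections from the input to layer $l$. There is no sign constraint on $W_1$, on the matrices $D_l$, or on the biases $b_l$. For a network with several outputs, convexity means that each output is (jointly) convex with respect to all the dimensions of the input. *)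

theory Defs
  imports "HOL-Analysis.Convex" "Jordan_Normal_Form.Matrix"
begin

text \<open>
  Layers are numbered from 1 and \<open>icnn W D b g l x\<close> is $z_l$ on input \<open>x\<close>. The value at
  \<open>0\<close> is only a totality convention; the remaining equations do not use it.
\<close>

fun icnn ::
  "(nat \<Rightarrow> real mat) \<Rightarrow> (nat \<Rightarrow> real mat) \<Rightarrow> (nat \<Rightarrow> real vec) \<Rightarrow> (nat \<Rightarrow> real \<Rightarrow> real) \<Rightarrow>
    nat \<Rightarrow> real vec \<Rightarrow> real vec" where
  "icnn W D b g 0 x = x"
| "icnn W D b g (Suc 0) x = map_vec (g 1) (W 1 *\<^sub>v x + b 1)"
| "icnn W D b g (Suc (Suc l)) x =
    map_vec (g (Suc (Suc l)))
      (W (Suc (Suc l)) *\<^sub>v icnn W D b g (Suc l) x + D (Suc (Suc l)) *\<^sub>v x + b (Suc (Suc l)))"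

text \<open>
  The type \<open>real vec\<close> contains vectors of all dimensions and is not an instance of
  \<open>real_vector\<close>, so \<open>convex_on\<close> does not apply to it. The following is the definition of
  \<open>convex_on\<close> transcribed to the carrier \<open>carrier_vec n\<close>.
\<close>

definition convex_on_carrier_vec :: "nat \<Rightarrow> (real vec \<Rightarrow> real) \<Rightarrow> bool" where
  "convex_on_carrier_vec n f \<longleftrightarrow>
    (\<forall>x\<in>carrier_vec n. \<forall>y\<in>carrier_vec n. \<forall>u\<ge>0. \<forall>v\<ge>0. u + v = 1 \<longrightarrow>
      f (u \<cdot>\<^sub>v x + v \<cdot>\<^sub>v y) \<le> u * f x + v * f y)"

end

theory Submission
  imports Defs
begin

text \<open>
  A pre-activation is a non-negative combination of convex functions plus an affine function of
  the input, hence convex, and a non-decreasing convex function of a convex function is convex.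
  Induct on the layer; in the first layer the pre-activation is affine, so no sign condition on
  the first weight matrix is needed.
\<close>

text \<open>Only values on the carrier enter the inequality, because the carrier is closed under the
  combinations involved. As a congruence rule this lets the simplifier use equations that hold only
  for \<open>x\<close> of the right dimension.\<close>

lemma convex_on_carrier_vec_cong:
  assumes "\<And>x. x \<in> carrier_vec n \<Longrightarrow> f x = h x"
  shows "convex_on_carrier_vec n f \<longleftrightarrow> convex_on_carrier_vec n h"
  unfolding convex_on_carrier_vec_def using assms by auto

lemma convex_on_carrier_vec_const: "convex_on_carrier_vec n (\<lambda>x. c)"
  unfolding convex_on_carrier_vec_def by (auto simp flip: distrib_right)

lemma convex_on_carrier_vec_add:
  assumes "convex_on_carrier_vec n f" "convex_on_carrier_vec n h"
  shows "convex_on_carrier_vec n (\<lambda>x. f x + h x)"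
  unfolding convex_on_carrier_vec_def
proof (intro ballI allI impI)
  fix x y :: "real vec" and u v :: real
  assume "x \<in> carrier_vec n" "y \<in> carrier_vec n" "0 \<le> u" "0 \<le> v" "u + v = 1"
  then have "f (u \<cdot>\<^sub>v x + v \<cdot>\<^sub>v y) \<le> u * f x + v * f y" "h (u \<cdot>\<^sub>v x + v \<cdot>\<^sub>v y) \<le> u * h x + v * h y"
    using assms unfolding convex_on_carrier_vec_def by blast+
  then show "f (u \<cdot>\<^sub>v x + v \<cdot>\<^sub>v y) + h (u \<cdot>\<^sub>v x + v \<cdot>\<^sub>v y) \<le> u * (f x + h x) + v * (f y + h y)"
    by (simp add: distrib_left)
qed

lemma convex_on_carrier_vec_cmul:
  assumes "0 \<le> c" "convex_on_carrier_vec n f"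
  shows "convex_on_carrier_vec n (\<lambda>x. c * f x)"
  unfolding convex_on_carrier_vec_def
proof (intro ballI allI impI)
  fix x y :: "real vec" and u v :: real
  assume "x \<in> carrier_vec n" "y \<in> carrier_vec n" "0 \<le> u" "0 \<le> v" "u + v = 1"
  then have "f (u \<cdot>\<^sub>v x + v \<cdot>\<^sub>v y) \<le> u * f x + v * f y"
    using assms(2) unfolding convex_on_carrier_vec_def by blast
  from mult_left_mono[OF this assms(1)]
  show "c * f (u \<cdot>\<^sub>v x + v \<cdot>\<^sub>v y) \<le> u * (c * f x) + v * (c * f y)"
    by (simp add: algebra_simps)
qed

lemma convex_on_carrier_vec_sum:
  assumes "\<And>j. j \<in> J \<Longrightarrow> convex_on_carrier_vec n (f j)"
  shows "convex_on_carrier_vec n (\<lambda>x. \<Sum>j\<in>J. f j x)"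
  using assms
  \<comment> \<open>For infinite \<open>J\<close> the sum is 0 by convention, so this case, like the
    empty one, is that of a constant.\<close>
  by (induction J rule: infinite_finite_induct)
    (simp_all add: convex_on_carrier_vec_const convex_on_carrier_vec_add)

text \<open>By linearity the inequality is an equality, whatever the signs of the entries. This
  serves \<open>W 1\<close> and the passthrough matrices.\<close>

lemma convex_on_carrier_vec_mult_mat_vec:
  assumes "A \<in> carrier_mat k n" "i < k"
  shows "convex_on_carrier_vec n (\<lambda>x. (A *\<^sub>v x) $ i)"
  unfolding convex_on_carrier_vec_def
proof (intro ballI allI impI)
  fix x y :: "real vec" and u v :: real
  assume "x \<in> carrier_vec n" "y \<in> carrier_vec n"
  with assms(1) have "A *\<^sub>v (u \<cdot>\<^sub>v x + v \<cdot>\<^sub>v y) = u \<cdot>\<^sub>v (A *\<^sub>v x) + v \<cdot>\<^sub>v (A *\<^sub>v y)"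
    by (simp add: mult_add_distrib_mat_vec[of A k n] mult_mat_vec[of A k n])
  then show "(A *\<^sub>v (u \<cdot>\<^sub>v x + v \<cdot>\<^sub>v y)) $ i \<le> u * (A *\<^sub>v x) $ i + v * (A *\<^sub>v y) $ i"
    using assms by simp
qed

text \<open>Entry \<open>i\<close> of the product is a combination of the entries of
  \<open>F x\<close> whose coefficients are row \<open>i\<close> of \<open>A\<close>. This is where
  the sign condition on the later weights acts.\<close>

lemma convex_on_carrier_vec_mult_mat_vec_nonneg:
  assumes A: "A \<in> carrier_mat k r" and i: "i < k"
    and nonneg: "\<And>j. j < r \<Longrightarrow> 0 \<le> A $$ (i, j)"
    and F: "\<And>x. x \<in> carrier_vec n \<Longrightarrow> F x \<in> carrier_vec r"
    and conv: "\<And>j. j < r \<Longrightarrow> convex_on_carrier_vec n (\<lambda>x. F x $ j)"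
  shows "convex_on_carrier_vec n (\<lambda>x. (A *\<^sub>v F x) $ i)"
proof -
  \<comment> \<open>The scalar product sums up to the dimension of \<open>F x\<close>, known to be
    \<open>r\<close> only for \<open>x\<close> in the carrier.\<close>
  have "(A *\<^sub>v F x) $ i = (\<Sum>j\<in>{0..<r}. A $$ (i, j) * F x $ j)" if "x \<in> carrier_vec n" for x
    using F[OF that] A i by (simp add: scalar_prod_def)
  moreover have "convex_on_carrier_vec n (\<lambda>x. \<Sum>j\<in>{0..<r}. A $$ (i, j) * F x $ j)"
    by (intro convex_on_carrier_vec_sum convex_on_carrier_vec_cmul) (use nonneg conv in auto)
  ultimately show ?thesis
    by (simp cong: convex_on_carrier_vec_cong)
qed

lemma convex_on_carrier_vec_compose:
  assumes "convex_on UNIV g" "mono g" "convex_on_carrier_vec n f"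
  shows "convex_on_carrier_vec n (\<lambda>x. g (f x))"
  unfolding convex_on_carrier_vec_def
proof (intro ballI allI impI)
  fix x y :: "real vec" and u v :: real
  assume *: "x \<in> carrier_vec n" "y \<in> carrier_vec n" "0 \<le> u" "0 \<le> v" "u + v = 1"
  then have "f (u \<cdot>\<^sub>v x + v \<cdot>\<^sub>v y) \<le> u * f x + v * f y"
    using assms(3) unfolding convex_on_carrier_vec_def by blast
  \<comment> \<open>Monotonicity carries the convexity inequality of \<open>f\<close> through
    \<open>g\<close>; convexity of \<open>g\<close> then splits the right-hand side.\<close>
  with assms(2) have "g (f (u \<cdot>\<^sub>v x + v \<cdot>\<^sub>v y)) \<le> g (u * f x + v * f y)"
    by (rule monoD)
  also have "\<dots> \<le> u * g (f x) + v * g (f y)"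
    using assms(1) * unfolding convex_on_def by simp
  finally show "g (f (u \<cdot>\<^sub>v x + v \<cdot>\<^sub>v y)) \<le> u * g (f x) + v * g (f y)" .
qed

text \<open>A vector sum takes the dimension of its right summand, here \<open>b l\<close>, and
  \<open>map_vec\<close> preserves it. Hence the bias alone fixes the dimension of a layer.\<close>

lemma icnn_carrier:
  assumes "1 \<le> l" "b l \<in> carrier_vec k"
  shows "icnn W D b g l x \<in> carrier_vec k"
  using assms by (cases "(W, D, b, g, l, x)" rule: icnn.cases) (auto intro!: carrier_vecI)

theorem proposition1:
  fixes m :: nat and n :: "nat \<Rightarrow> nat"
    and W D :: "nat \<Rightarrow> real mat" and b :: "nat \<Rightarrow> real vec" and g :: "nat \<Rightarrow> real \<Rightarrow> real"
  assumes "1 \<le> m"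
    and "\<And>l. l \<in> {1..m} \<Longrightarrow> W l \<in> carrier_mat (n l) (n (l - 1))"
    and "\<And>l. l \<in> {2..m} \<Longrightarrow> D l \<in> carrier_mat (n l) (n 0)"
    and "\<And>l. l \<in> {1..m} \<Longrightarrow> b l \<in> carrier_vec (n l)"
    and "\<And>l i j. l \<in> {2..m} \<Longrightarrow> i < n l \<Longrightarrow> j < n (l - 1) \<Longrightarrow> 0 \<le> W l $$ (i, j)"
    and "\<And>l. l \<in> {1..m} \<Longrightarrow> convex_on UNIV (g l)"
    and "\<And>l. l \<in> {1..m} \<Longrightarrow> mono (g l)"
  shows "\<forall>i < n m. convex_on_carrier_vec (n 0) (\<lambda>x. icnn W D b g m x $ i)"
proof -
  \<comment> \<open>The induction runs over the layers \<open>l\<close> \<le> \<open>m\<close> of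
    the fixed network, since the assumptions cover only these.\<close>
  have "\<forall>i < n l. convex_on_carrier_vec (n 0) (\<lambda>x. icnn W D b g l x $ i)"
    if "1 \<le> l" "l \<le> m" for l
    using that
  proof (induction l rule: nat_induct_at_least)
    case base
    show ?case
    proof (intro allI impI)
      fix i assume i: "i < n 1"
      have W: "W 1 \<in> carrier_mat (n 1) (n 0)" and b: "b 1 \<in> carrier_vec (n 1)"
        and g: "convex_on UNIV (g 1)" "mono (g 1)"
        using assms(2,4,6,7)[of 1] base by simp_all
      have "icnn W D b g 1 x $ i = g 1 ((W 1 *\<^sub>v x) $ i + b 1 $ i)" for x
        using W b i by simp
      moreover have "convex_on_carrier_vec (n 0) (\<lambda>x. g 1 ((W 1 *\<^sub>v x) $ i + b 1 $ i))"
        by (intro convex_on_carrier_vec_compose[OF g] convex_on_carrier_vec_add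
            convex_on_carrier_vec_mult_mat_vec[OF W i] convex_on_carrier_vec_const)
      ultimately show "convex_on_carrier_vec (n 0) (\<lambda>x. icnn W D b g 1 x $ i)"
        by simp
    qed
  next
    case (Suc l)
    let ?z = "icnn W D b g"
    show ?case
    proof (intro allI impI)
      fix i assume i: "i < n (Suc l)"
      have W: "W (Suc l) \<in> carrier_mat (n (Suc l)) (n l)"
        and D: "D (Suc l) \<in> carrier_mat (n (Suc l)) (n 0)"
        and b: "b (Suc l) \<in> carrier_vec (n (Suc l))"
        and nonneg: "\<And>j. j < n l \<Longrightarrow> 0 \<le> W (Suc l) $$ (i, j)"
        and g: "convex_on UNIV (g (Suc l))" "mono (g (Suc l))"
        using assms(2-7)[of "Suc l"] Suc.hyps Suc.prems i by simp_all
      have z: "?z l x \<in> carrier_vec (n l)" for x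
        using assms(4)[of l] Suc.hyps Suc.prems by (intro icnn_carrier) simp_all
      have "?z (Suc l) x $ i
          = g (Suc l) ((W (Suc l) *\<^sub>v ?z l x) $ i + (D (Suc l) *\<^sub>v x) $ i + b (Suc l) $ i)" for x
        \<comment> \<open>Writing \<open>l\<close> as a successor exposes the pattern of the third
          equation of \<open>icnn\<close>; \<open>l = 0\<close> contradicts 1 \<le>
          \<open>l\<close>.\<close>
        using W D b i Suc.hyps by (cases l) simp_all
      moreover have "convex_on_carrier_vec (n 0)
          (\<lambda>x. g (Suc l) ((W (Suc l) *\<^sub>v ?z l x) $ i + (D (Suc l) *\<^sub>v x) $ i + b (Suc l) $ i))"
        \<comment> \<open>The induction hypothesis supplies convexity of each entry of
          \<open>?z l\<close>, the one premise left open by the instantiated rule for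
          \<open>W (Suc l)\<close>.\<close>
        using Suc.IH Suc.prems
        by (intro convex_on_carrier_vec_compose[OF g] convex_on_carrier_vec_add
            convex_on_carrier_vec_mult_mat_vec_nonneg[OF W i nonneg z]
            convex_on_carrier_vec_mult_mat_vec[OF D i] convex_on_carrier_vec_const) simp_all
      ultimately show "convex_on_carrier_vec (n 0) (\<lambda>x. ?z (Suc l) x $ i)"
        by simp
    qed
  qed
  with assms(1) show ?thesis
    by blast
qed

end
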